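(* Let $n\ge 3$ and let $F_n^1$ be the complex Leibniz algebra with basis $\{e_1,\dots,e_n\}$ and $[e_1,e_1]=e_3$, $[e_i,e_1]=e_{i+1}$ for $2\le i\le n-1$. Every four-dimensional non-split central extension of $F_n^1$ is isomorphic to the following algebra with basis $\{e_1,\dots,e_{n+4}\}$: $$\left\{\begin{array}{ll}[e_i,e_1]=e_{i+1},&1\le i\le n-2,\\ [e_{n-1},e_1]=e_{n+2},&\\ [e_n,e_1]=e_2+e_{n+1},&\\ [e_1,e_n]=e_{n+3},&\\ [e_n,e_n]=e_{n+4}.&\end{array}\right.$$
   Context: All vector spaces and algebras are finite-dimensional over $\mathbb{C}$; in multiplication tables omitted products of basis elements are zero. A Leibniz algebra is an algebra $L$ with bilinear product satisfying $[x,[y,z]]=[[x,y],z]-[[x,z],y]$. A $k$-dimensional central extension of a Leibniz algebra $L$ is a Leibniz algebra $\widehat L$ fitting into a short exact sequence of Leibniz algebras $0\to V\to\widehat L\to L\to0$ with $\dim V=k$ and the image of $V$ contained in the center of $\widehat L$; equivalently $\widehat L\cong L\oplus V$ with product $[x+u,y+v]=[x,y]_L+\theta(x,y)$, where $\theta:L\times L\to V$ is bilinear with $\theta(x,[y,z])=\theta([x,y],z)-\theta([x,z],y)$. A $k$-dimensional central extension of $L$ is split if, as an algebra, it is isomorphic to $L'\oplus\mathbb{C}$, where $L'$ is a $(k-1)$-dimensional central extension of $L$ and $\mathbb{C}$ is the one-dimensional abelian algebra; otherwise it is non-split. *)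

theory Defs
  imports Complex_Main "HOL-Library.Function_Algebras" "HOL-Library.Product_Plus"
begin

(* The underlying vector space of an algebra is a subspace "carr" of an ambient complex
   vector space (a whole type); scl is the ambient scalar multiplication, and brk is only
   meaningful on carr. *)
record 'a calgebra =
  carr :: "'a set"
  scl :: "complex \<Rightarrow> 'a \<Rightarrow> 'a"
  brk :: "'a \<Rightarrow> 'a \<Rightarrow> 'a"

locale leibniz_algebra = vector_space "scl A" for A :: "'a::ab_group_add calgebra" +
  assumes subspace_carr: "subspace (carr A)"
    and finite_dim: "\<exists>B. finite B \<and> B \<subseteq> carr A \<and> span B = carr A"
    and brk_closed: "\<lbrakk>x \<in> carr A; y \<in> carr A\<rbrakk> \<Longrightarrow> brk A x y \<in> carr A"
    and brk_add_left: "\<lbrakk>x \<in> carr A; y \<in> carr A; z \<in> carr A\<rbrakk>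
      \<Longrightarrow> brk A (x + y) z = brk A x z + brk A y z"
    and brk_add_right: "\<lbrakk>x \<in> carr A; y \<in> carr A; z \<in> carr A\<rbrakk>
      \<Longrightarrow> brk A x (y + z) = brk A x y + brk A x z"
    and brk_scl_left: "\<lbrakk>x \<in> carr A; y \<in> carr A\<rbrakk> \<Longrightarrow> brk A (scl A c x) y = scl A c (brk A x y)"
    and brk_scl_right: "\<lbrakk>x \<in> carr A; y \<in> carr A\<rbrakk> \<Longrightarrow> brk A x (scl A c y) = scl A c (brk A x y)"
    and leibniz: "\<lbrakk>x \<in> carr A; y \<in> carr A; z \<in> carr A\<rbrakk>
      \<Longrightarrow> brk A x (brk A y z) = brk A (brk A x y) z - brk A (brk A x z) y"

definition alg_dim :: "'a::ab_group_add calgebra \<Rightarrow> nat" where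
  "alg_dim A = vector_space.dim (scl A) (carr A)"

definition alg_hom :: "'a::ab_group_add calgebra \<Rightarrow> 'b::ab_group_add calgebra \<Rightarrow> ('a \<Rightarrow> 'b) \<Rightarrow> bool"
  where
  "alg_hom A B f \<longleftrightarrow>
     (\<forall>x\<in>carr A. f x \<in> carr B) \<and>
     (\<forall>x\<in>carr A. \<forall>y\<in>carr A. f (x + y) = f x + f y) \<and>
     (\<forall>c. \<forall>x\<in>carr A. f (scl A c x) = scl B c (f x)) \<and>
     (\<forall>x\<in>carr A. \<forall>y\<in>carr A. f (brk A x y) = brk B (f x) (f y))"

definition alg_iso :: "'a::ab_group_add calgebra \<Rightarrow> 'b::ab_group_add calgebra \<Rightarrow> bool"
    (infix "\<simeq>" 50) where
  "A \<simeq> B \<longleftrightarrow> (\<exists>f. alg_hom A B f \<and> bij_betw f (carr A) (carr B))"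

definition center :: "'a::ab_group_add calgebra \<Rightarrow> 'a set" where
  "center A = {x \<in> carr A. \<forall>y\<in>carr A. brk A x y = 0 \<and> brk A y x = 0}"

definition alg_sum :: "'a calgebra \<Rightarrow> 'b calgebra \<Rightarrow> ('a \<times> 'b) calgebra" (infixr "\<oplus>" 65) where
  "A \<oplus> B = \<lparr>carr = carr A \<times> carr B,
            scl = (\<lambda>c (x, y). (scl A c x, scl B c y)),
            brk = (\<lambda>(x, y) (x', y'). (brk A x x', brk B y y'))\<rparr>"

definition abelian_line :: "complex calgebra" where
  "abelian_line = \<lparr>carr = UNIV, scl = (*), brk = (\<lambda>x y. 0)\<rparr>"

definition short_exact ::
  "'v::ab_group_add calgebra \<Rightarrow> 'e::ab_group_add calgebra \<Rightarrow> 'l::ab_group_add calgebra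
     \<Rightarrow> ('v \<Rightarrow> 'e) \<Rightarrow> ('e \<Rightarrow> 'l) \<Rightarrow> bool" where
  "short_exact V E L f g \<longleftrightarrow>
     alg_hom V E f \<and> alg_hom E L g \<and>
     inj_on f (carr V) \<and> f ` carr V = {x \<in> carr E. g x = 0} \<and> g ` carr E = carr L"

(* V is taken in the ambient type of E; since V embeds in E, this loses no generality. *)
definition central_extension ::
  "nat \<Rightarrow> 'l::ab_group_add calgebra \<Rightarrow> 'e::ab_group_add calgebra \<Rightarrow> bool" where
  "central_extension k L E \<longleftrightarrow>
     leibniz_algebra L \<and> leibniz_algebra E \<and>
     (\<exists>(V :: 'e calgebra) f g.
        leibniz_algebra V \<and> alg_dim V = k \<and> short_exact V E L f g \<and> f ` carr V \<subseteq> center E)"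

(* L' is taken in the ambient type of E; since an L' with E isomorphic to L' (+) C embeds in E,
   this loses no generality. *)
definition split_extension ::
  "nat \<Rightarrow> 'l::ab_group_add calgebra \<Rightarrow> 'e::ab_group_add calgebra \<Rightarrow> bool" where
  "split_extension k L E \<longleftrightarrow> central_extension k L E \<and> k \<ge> 1 \<and>
     (\<exists>L' :: 'e calgebra. central_extension (k - 1) L L' \<and> E \<simeq> L' \<oplus> abelian_line)"

definition nonsplit_extension ::
  "nat \<Rightarrow> 'l::ab_group_add calgebra \<Rightarrow> 'e::ab_group_add calgebra \<Rightarrow> bool" where
  "nonsplit_extension k L E \<longleftrightarrow> central_extension k L E \<and> \<not> split_extension k L E"

definition bvec :: "nat \<Rightarrow> nat \<Rightarrow> complex" where
  "bvec i = (\<lambda>j. if j = i then 1 else 0)"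

(* The algebra with basis bvec 1, ..., bvec d and multiplication table [bvec i, bvec j] = t i j. *)
definition table_algebra :: "nat \<Rightarrow> (nat \<Rightarrow> nat \<Rightarrow> nat \<Rightarrow> complex) \<Rightarrow> (nat \<Rightarrow> complex) calgebra"
  where
  "table_algebra d t =
     \<lparr>carr = {x. \<forall>i. i \<notin> {1..d} \<longrightarrow> x i = 0},
      scl = (\<lambda>c x k. c * x k),
      brk = (\<lambda>x y k. \<Sum>i=1..d. \<Sum>j=1..d. x i * y j * t i j k)\<rparr>"

definition F1 :: "nat \<Rightarrow> (nat \<Rightarrow> complex) calgebra" where
  "F1 n = table_algebra n (\<lambda>i j.
     if i = 1 \<and> j = 1 then bvec 3
     else if 2 \<le> i \<and> i \<le> n - 1 \<and> j = 1 then bvec (i + 1)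
     else 0)"

definition F1_ext4 :: "nat \<Rightarrow> (nat \<Rightarrow> complex) calgebra" where
  "F1_ext4 n = table_algebra (n + 4) (\<lambda>i j.
     if 1 \<le> i \<and> i \<le> n - 2 \<and> j = 1 then bvec (i + 1)
     else if i = n - 1 \<and> j = 1 then bvec (n + 2)
     else if i = n \<and> j = 1 then bvec 2 + bvec (n + 1)
     else if i = 1 \<and> j = n then bvec (n + 3)
     else if i = n \<and> j = n then bvec (n + 4)
     else 0)"

lemma vector_space_table: "vector_space (scl (table_algebra d t))"
  by unfold_locales (auto simp: table_algebra_def fun_eq_iff algebra_simps)

lemma finite_span_table:
  assumes "x \<in> carr (table_algebra d t)"
  shows "x \<in> module.span (scl (table_algebra d t)) (bvec ` {1..d})"
proof -
  interpret vector_space "scl (table_algebra d t)" by (rule vector_space_table)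
  have s: "(\<Sum>i\<in>I. f i) k = (\<Sum>i\<in>I. f i k)" if "finite I" for I :: "nat set"
    and f :: "nat \<Rightarrow> nat \<Rightarrow> complex" and k
    using that by (induction I) auto
  have "(\<Sum>i=1..d. scl (table_algebra d t) (x i) (bvec i)) = x"
  proof
    fix k
    have "(\<Sum>i=1..d. scl (table_algebra d t) (x i) (bvec i)) k = (\<Sum>i=1..d. if i = k then x i else 0)"
      unfolding s[OF finite_atLeastAtMost] by (intro sum.cong) (auto simp: table_algebra_def bvec_def)
    also have "\<dots> = x k"
      using assms by (auto simp: table_algebra_def)
    finally show "(\<Sum>i=1..d. scl (table_algebra d t) (x i) (bvec i)) k = x k" .
  qed
  moreover have "(\<Sum>i=1..d. scl (table_algebra d t) (x i) (bvec i)) \<in> span (bvec ` {1..d})"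
    by (intro span_sum span_scale span_base) auto
  ultimately show ?thesis by simp
qed

lemma leibniz_table:
  fixes d t
  defines "A \<equiv> table_algebra d t"
  assumes cl: "\<And>i j. i \<in> {1..d} \<Longrightarrow> j \<in> {1..d} \<Longrightarrow> t i j \<in> carr A"
    and lb: "\<And>x y z. \<lbrakk>x \<in> carr A; y \<in> carr A; z \<in> carr A\<rbrakk>
      \<Longrightarrow> brk A x (brk A y z) = brk A (brk A x y) z - brk A (brk A x z) y"
  shows "leibniz_algebra A"
proof -
  interpret vector_space "scl A" unfolding A_def by (rule vector_space_table)
  have sub: "subspace (carr A)"
    unfolding subspace_def by (auto simp: A_def table_algebra_def)
  have "bvec ` {1..d} \<subseteq> carr A" by (auto simp: A_def table_algebra_def bvec_def)
  then have sp: "span (bvec ` {1..d}) = carr A"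
    using finite_span_table[of _ d t] span_minimal[OF _ sub] unfolding A_def by blast
  show ?thesis
  proof
    show "\<exists>B. finite B \<and> B \<subseteq> carr A \<and> span B = carr A"
      using sp \<open>bvec ` {1..d} \<subseteq> carr A\<close> by blast
    show "brk A x y \<in> carr A" if "x \<in> carr A" "y \<in> carr A" for x y
      using cl by (auto simp: A_def table_algebra_def intro!: sum.neutral)
  qed (use sub lb in \<open>auto simp: A_def table_algebra_def fun_eq_iff sum.distrib sum_distrib_left
        distrib_left distrib_right mult_ac\<close>)
qed

lemma brk_F1:
  assumes "n \<ge> 3"
  shows "brk (F1 n) x y = (\<lambda>k. y 1 * (if k = 3 then x 1 + x 2
    else if 4 \<le> k \<and> k \<le> n then x (k - 1) else 0))"
proof
  fix k
  have "brk (F1 n) x y k = (\<Sum>i=1..n. \<Sum>j=1..n. if j = 1 then x i * y 1 *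
     (if i = 1 then bvec 3 k else if 2 \<le> i \<and> i \<le> n - 1 then bvec (i + 1) k else 0) else 0)"
    unfolding F1_def table_algebra_def calgebra.simps by (intro sum.cong refl) auto
  also have "\<dots> = (\<Sum>i=1..n. x i * y 1 *
     (if i = 1 then bvec 3 k else if 2 \<le> i \<and> i \<le> n - 1 then bvec (i + 1) k else 0))"
    using assms by (intro sum.cong refl) (subst sum.delta, auto)
  also have "\<dots> = (\<Sum>i=1..n. (if i = 1 then (if k = 3 then y 1 * x 1 else 0) else 0)
      + (if i = k - 1 then (if 3 \<le> k \<and> k \<le> n then y 1 * x (k - 1) else 0) else 0))"
    using assms by (intro sum.cong) (auto simp: bvec_def)
  also have "\<dots> = y 1 * (if k = 3 then x 1 + x 2 else if 4 \<le> k \<and> k \<le> n then x (k - 1) else 0)"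
    using assms by (auto simp: sum.distrib algebra_simps)
  finally show "brk (F1 n) x y k = y 1 * (if k = 3 then x 1 + x 2
    else if 4 \<le> k \<and> k \<le> n then x (k - 1) else 0)" .
qed

lemma leibniz_F1:
  assumes "n \<ge> 3"
  shows "leibniz_algebra (F1 n)"
  unfolding F1_def
proof (rule leibniz_table, fold F1_def)
  show "brk (F1 n) x (brk (F1 n) y z) = brk (F1 n) (brk (F1 n) x y) z - brk (F1 n) (brk (F1 n) x z) y"
    for x y z
    using assms by (auto simp: brk_F1 fun_eq_iff)
qed (use assms in \<open>auto simp: F1_def table_algebra_def bvec_def\<close>)

end

theory Submission
  imports Defs
begin

text \<open>
  Let \<open>g : E \<rightarrow> F1 n\<close> be the projection of the extension, with central kernel \<open>K\<close> of dimension 4.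
  Two facts determine \<open>E\<close>.

  First, non-splitness forces \<open>K\<close> into the span of all brackets
  (\<open>kernel_in_derived_if_nonsplit\<close>). If some \<open>v\<close> in \<open>K\<close> is not in that span, choose a linear
  functional that is 1 at \<open>v\<close> and 0 on all brackets; its kernel is then an ideal complementary to
  the central line through \<open>v\<close>, still projects onto \<open>F1 n\<close>, and loses one dimension of \<open>K\<close>, so
  that the extension splits.

  Secondly, brackets in any central extension depend only on lifts of the two generators. Let \<open>a\<close>
  and \<open>b\<close> lift \<open>e\<^sub>1\<close> and \<open>e\<^sub>2\<close>, and put \<open>c\<^sub>1 = a\<close>, \<open>c\<^sub>m\<^sub>+\<^sub>1 = [c\<^sub>m, a]\<close>. The Leibniz identity gives
  \<open>[x, c\<^sub>m] = 0\<close> for all \<open>x\<close> and, since \<open>[a, b]\<close> is central, \<open>[c\<^sub>m, b] = 0\<close> for \<open>m \<ge> 2\<close>. The only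
  brackets left free are \<open>[b, a]\<close>, \<open>[a, b]\<close>, \<open>[b, b]\<close> and the last link \<open>c\<^sub>n\<close> of the chain, and the
  multiplication table of \<open>F1_ext4 n\<close> is satisfied in \<open>E\<close> by
  \<open>c\<^sub>1, ..., c\<^sub>n\<^sub>-\<^sub>1, b, [b, a] - [a, a], c\<^sub>n, [a, b], [b, b]\<close> (\<open>lin_comb_ext_basis_hom\<close>).

  The resulting homomorphism \<open>F1_ext4 n \<rightarrow> E\<close> is onto modulo \<open>K\<close>; as \<open>K\<close> is central, its image
  contains all brackets of \<open>E\<close>, hence \<open>K\<close> by the first fact, hence all of \<open>E\<close>. The last four
  vectors therefore span the four-dimensional \<open>K\<close>, so they are independent, and the homomorphism is
  injective (\<open>iso_F1_ext4\<close>).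
\<close>

section \<open>Algebra homomorphisms and linear combinations\<close>

lemma sum_fun_at: "(\<Sum>i\<in>I. f i) k = (\<Sum>i\<in>I. f i k)"
  for f :: "'i \<Rightarrow> 'j \<Rightarrow> 'b::ab_group_add"
  by (induction I rule: infinite_finite_induct) auto

lemma alg_homD:
  assumes "alg_hom A B f"
  shows "x \<in> carr A \<Longrightarrow> f x \<in> carr B"
    and "x \<in> carr A \<Longrightarrow> y \<in> carr A \<Longrightarrow> f (x + y) = f x + f y"
    and "x \<in> carr A \<Longrightarrow> f (scl A c x) = scl B c (f x)"
    and "x \<in> carr A \<Longrightarrow> y \<in> carr A \<Longrightarrow> f (brk A x y) = brk B (f x) (f y)"
  using assms by (auto simp: alg_hom_def)

context leibniz_algebra
begin

lemma zero_in_carr: "0 \<in> carr A"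
  and add_in_carr: "x \<in> carr A \<Longrightarrow> y \<in> carr A \<Longrightarrow> x + y \<in> carr A"
  and diff_in_carr: "x \<in> carr A \<Longrightarrow> y \<in> carr A \<Longrightarrow> x - y \<in> carr A"
  and scl_in_carr: "x \<in> carr A \<Longrightarrow> scl A c x \<in> carr A"
  and sum_in_carr: "(\<And>i. i \<in> I \<Longrightarrow> h i \<in> carr A) \<Longrightarrow> sum h I \<in> carr A"
  using subspace_carr by (auto intro: subspace_0 subspace_add subspace_diff subspace_scale subspace_sum)

lemmas in_carr = zero_in_carr add_in_carr diff_in_carr scl_in_carr brk_closed

lemma hom_zero: "alg_hom A B f \<Longrightarrow> f 0 = 0"
  using alg_homD(2)[of A B f 0 0] zero_in_carr by simp

lemma hom_diff:
  assumes "alg_hom A B f" "x \<in> carr A" "y \<in> carr A"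
  shows "f (x - y) = f x - f y"
  using alg_homD(2)[OF assms(1) diff_in_carr[OF assms(2,3)] assms(3)] by (simp add: algebra_simps)

lemma hom_sum:
  assumes "alg_hom A B f" "\<And>i. i \<in> I \<Longrightarrow> h i \<in> carr A"
  shows "f (sum h I) = (\<Sum>i\<in>I. f (h i))"
  using assms(2)
  by (induction I rule: infinite_finite_induct)
    (simp_all add: hom_zero[OF assms(1)] alg_homD(2)[OF assms(1)] sum_in_carr)

lemma brk_zero_left: "y \<in> carr A \<Longrightarrow> brk A 0 y = 0"
  and brk_zero_right: "y \<in> carr A \<Longrightarrow> brk A y 0 = 0"
  using brk_add_left[of 0 0 y] brk_add_right[of y 0 0] zero_in_carr by auto

lemma brk_sum_left:
  assumes "\<And>i. i \<in> I \<Longrightarrow> h i \<in> carr A" "y \<in> carr A"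
  shows "brk A (sum h I) y = (\<Sum>i\<in>I. brk A (h i) y)"
  using assms
  by (induction I rule: infinite_finite_induct) (simp_all add: brk_zero_left brk_add_left sum_in_carr)

lemma brk_sum_right:
  assumes "\<And>i. i \<in> I \<Longrightarrow> h i \<in> carr A" "y \<in> carr A"
  shows "brk A y (sum h I) = (\<Sum>i\<in>I. brk A y (h i))"
  using assms
  by (induction I rule: infinite_finite_induct) (simp_all add: brk_zero_right brk_add_right sum_in_carr)

lemma brk_center_left: "z \<in> center A \<Longrightarrow> x \<in> carr A \<Longrightarrow> brk A z x = 0"
  and brk_center_right: "z \<in> center A \<Longrightarrow> x \<in> carr A \<Longrightarrow> brk A x z = 0"
  by (auto simp: center_def)

text \<open>Finite dimension passes to the subspace because an independent subset of a finitely spanned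
  space is finite.\<close>

lemma subalgebra:
  assumes sub: "subspace S" and S: "S \<subseteq> carr A"
    and cl: "\<And>x y. x \<in> S \<Longrightarrow> y \<in> S \<Longrightarrow> brk A x y \<in> S"
  shows "leibniz_algebra (A\<lparr>carr := S\<rparr>)"
proof -
  obtain C where C: "finite C" "span C = carr A" using finite_dim by blast
  obtain B where B: "B \<subseteq> S" "independent B" "S \<subseteq> span B" using basis_exists by metis
  have "finite B" using independent_span_bound[OF C(1) B(2)] B(1) S C(2) by blast
  moreover have "span B = S" using B span_minimal[OF B(1) sub] by blast
  ultimately have fin: "\<exists>B. finite B \<and> B \<subseteq> S \<and> span B = S" using B(1) by blast
  have "vector_space (scl A)" ..
  then interpret S: vector_space "scl (A\<lparr>carr := S\<rparr>)" by simp
  show ?thesis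
  proof
    fix x y z assume "x \<in> carr (A\<lparr>carr := S\<rparr>)" "y \<in> carr (A\<lparr>carr := S\<rparr>)" "z \<in> carr (A\<lparr>carr := S\<rparr>)"
    then have "x \<in> carr A" "y \<in> carr A" "z \<in> carr A" using S by auto
    from leibniz[OF this]
    show "brk (A\<lparr>carr := S\<rparr>) x (brk (A\<lparr>carr := S\<rparr>) y z)
      = brk (A\<lparr>carr := S\<rparr>) (brk (A\<lparr>carr := S\<rparr>) x y) z - brk (A\<lparr>carr := S\<rparr>) (brk (A\<lparr>carr := S\<rparr>) x z) y"
      by simp
  qed (use sub fin cl S brk_add_left brk_add_right brk_scl_left brk_scl_right in \<open>auto simp: subset_iff\<close>)
qed

definition lin_comb :: "nat \<Rightarrow> (nat \<Rightarrow> 'a) \<Rightarrow> (nat \<Rightarrow> complex) \<Rightarrow> 'a" where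
  "lin_comb d u x = (\<Sum>i=1..d. scl A (x i) (u i))"

lemma lin_comb_add: "lin_comb d u (x + y) = lin_comb d u x + lin_comb d u y"
  by (simp add: lin_comb_def scale_left_distrib sum.distrib)

lemma lin_comb_scale: "lin_comb d u (\<lambda>k. c * x k) = scl A c (lin_comb d u x)"
  by (simp add: lin_comb_def scale_sum_right)

lemma lin_comb_0: "lin_comb d u 0 = 0"
  by (simp add: lin_comb_def)

lemma lin_comb_bvec: "m \<in> {1..d} \<Longrightarrow> lin_comb d u (bvec m) = u m"
proof -
  assume m: "m \<in> {1..d}"
  have "lin_comb d u (bvec m) = (\<Sum>i=1..d. if i = m then u i else 0)"
    unfolding lin_comb_def bvec_def by (intro sum.cong) auto
  then show ?thesis using m by simp
qed

lemma lin_comb_in_carr: "(\<And>i. i \<in> {1..d} \<Longrightarrow> u i \<in> carr A) \<Longrightarrow> lin_comb d u x \<in> carr A"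
  unfolding lin_comb_def by (intro sum_in_carr scl_in_carr)

text \<open>A homomorphism out of a table algebra may be prescribed by vectors that satisfy the
  multiplication table: both sides are bilinear in the coordinates.\<close>

lemma lin_comb_hom:
  assumes u: "\<And>i. i \<in> {1..d} \<Longrightarrow> u i \<in> carr A"
    and t: "\<And>i j. i \<in> {1..d} \<Longrightarrow> j \<in> {1..d} \<Longrightarrow> brk A (u i) (u j) = lin_comb d u (t i j)"
  shows "alg_hom (table_algebra d t) A (lin_comb d u)"
proof -
  have "lin_comb d u (brk (table_algebra d t) x y) = brk A (lin_comb d u x) (lin_comb d u y)" for x y
  proof -
    have "brk A (lin_comb d u x) (lin_comb d u y)
      = (\<Sum>i=1..d. brk A (scl A (x i) (u i)) (lin_comb d u y))"
      unfolding lin_comb_def[of d u x]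
      by (intro brk_sum_left scl_in_carr u lin_comb_in_carr) auto
    also have "\<dots> = (\<Sum>i=1..d. \<Sum>j=1..d. brk A (scl A (x i) (u i)) (scl A (y j) (u j)))"
      unfolding lin_comb_def
      by (intro sum.cong refl brk_sum_right scl_in_carr u) auto
    also have "\<dots> = (\<Sum>i=1..d. \<Sum>j=1..d. scl A (x i * y j) (lin_comb d u (t i j)))"
      by (intro sum.cong refl) (simp add: brk_scl_left brk_scl_right u scl_in_carr t mult.commute)
    also have "\<dots> = (\<Sum>i=1..d. \<Sum>j=1..d. \<Sum>k=1..d. scl A (x i * y j * t i j k) (u k))"
      by (simp add: lin_comb_def scale_sum_right)
    also have "\<dots> = (\<Sum>i=1..d. \<Sum>k=1..d. \<Sum>j=1..d. scl A (x i * y j * t i j k) (u k))"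
      by (intro sum.cong refl sum.swap)
    also have "\<dots> = (\<Sum>k=1..d. \<Sum>i=1..d. \<Sum>j=1..d. scl A (x i * y j * t i j k) (u k))"
      by (rule sum.swap)
    also have "\<dots> = lin_comb d u (brk (table_algebra d t) x y)"
      by (simp add: lin_comb_def table_algebra_def scale_sum_left)
    finally show ?thesis ..
  qed
  then show ?thesis
    unfolding alg_hom_def
    by (auto simp: lin_comb_add intro!: lin_comb_in_carr u)
      (simp_all add: table_algebra_def lin_comb_scale)
qed

text \<open>A family of as many vectors as the dimension of the space \<open>K\<close> it spans is a basis of \<open>K\<close>: a
  basis extracted from it cannot have fewer elements, so nothing repeats and nothing was discarded.\<close>

lemma independent_family:
  assumes fin: "finite I" and dim: "dim K = card I" and K: "K \<subseteq> span (u ` I)" "u ` I \<subseteq> K"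
    and zero: "(\<Sum>i\<in>I. scl A (z i) (u i)) = 0" and i: "i \<in> I"
  shows "z i = 0"
proof -
  obtain B where B: "B \<subseteq> u ` I" "independent B" "u ` I \<subseteq> span B"
    using basis_exists by metis
  have "card B = dim K"
    using B K span_minimal[OF B(3) subspace_span] by (intro basis_card_eq_dim) auto
  moreover have "card B \<le> card (u ` I)" using B(1) fin by (intro card_mono) auto
  moreover have "card (u ` I) \<le> card I" using fin by (rule card_image_le)
  ultimately have eq: "card B = card (u ` I)" "card (u ` I) = card I" using dim by auto
  have inj: "inj_on u I" using eq_card_imp_inj_on[OF fin eq(2)] .
  have "B = u ` I" using card_subset_eq[OF _ B(1) eq(1)] fin by auto
  then have ind: "independent (u ` I)" using B by simp
  have "(\<Sum>v\<in>u ` I. scl A (z (inv_into I u v)) v) = 0"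
    using zero by (simp add: sum.reindex[OF inj] inj)
  from independentD[OF ind _ order_refl this, of "u i"] show ?thesis using fin i inj by simp
qed

text \<open>A basis of the span together with \<open>v\<close> is independent, so values on it may be prescribed.\<close>

lemma ex_functional:
  assumes "v \<notin> span D"
  shows "\<exists>\<phi>. Vector_Spaces.linear (scl A) ((*) :: complex \<Rightarrow> complex \<Rightarrow> complex) \<phi> \<and> \<phi> v = 1 \<and> (\<forall>x\<in>span D. \<phi> x = 0)"
proof -
  interpret C: vector_space "(*) :: complex \<Rightarrow> complex \<Rightarrow> complex"
    by unfold_locales (auto simp: algebra_simps)
  interpret P: vector_space_pair "scl A" "(*) :: complex \<Rightarrow> complex \<Rightarrow> complex" ..
  obtain B where B: "B \<subseteq> D" "independent B" "D \<subseteq> span B" using basis_exists by metis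
  have DB: "span D = span B"
    using B span_minimal[OF B(3) subspace_span] span_mono[OF B(1)] by auto
  have "independent (insert v B)" using B assms DB by (intro independent_insertI) auto
  from P.linear_independent_extend[OF this, of "\<lambda>x. if x = v then 1 else 0"]
  obtain \<phi> where \<phi>: "Vector_Spaces.linear (scl A) (*) \<phi>" "\<forall>x\<in>insert v B. \<phi> x = (if x = v then 1 else 0)" by blast
  have "v \<notin> B" using assms DB span_base by auto
  then have B0: "\<phi> x = 0" if "x \<in> B" for x using \<phi>(2) that by auto
  have "\<phi> x = 0" if "x \<in> span B" for x
    using P.linear_eq_0_on_span[OF \<phi>(1) B0 that] .
  then show ?thesis using \<phi> DB by auto
qed

end

text \<open>The two carriers lie in spaces with different scalar multiplications, and \<open>f\<close> is linear only
  on \<open>carr V\<close>. It agrees there with the globally defined linear map that has the same values on a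
  basis of \<open>carr V\<close>.\<close>

lemma dim_injective_hom_image:
  assumes "leibniz_algebra V" "leibniz_algebra E" and f: "alg_hom V E f" "inj_on f (carr V)"
  shows "vector_space.dim (scl E) (f ` carr V) = alg_dim V"
proof -
  interpret V: leibniz_algebra V by fact
  interpret E: leibniz_algebra E by fact
  interpret P: vector_space_pair "scl V" "scl E" ..
  obtain B where B: "B \<subseteq> carr V" "V.independent B" "carr V \<subseteq> V.span B" "card B = V.dim (carr V)"
    using V.basis_exists .
  have span: "V.span B = carr V" using B V.span_minimal[OF B(1) V.subspace_carr] by auto
  from P.linear_independent_extend[OF B(2), of f]
  obtain h where h: "Vector_Spaces.linear (scl V) (scl E) h" "\<forall>x\<in>B. h x = f x" by blast
  have hh: "h (x + y) = h x + h y" "h (scl V c x) = scl E c (h x)" for x y c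
    using h(1) by (auto simp: Vector_Spaces.linear_iff)
  have h0: "h 0 = 0" using hh(1)[of 0 0] by simp
  have "V.subspace {x \<in> carr V. h x = f x}"
    by (auto simp: V.subspace_def V.in_carr hh h0 alg_homD[OF f(1)] V.hom_zero[OF f(1)])
  then have "V.span B \<subseteq> {x \<in> carr V. h x = f x}"
    using B(1) h(2) by (intro V.span_minimal) auto
  then have hf: "h x = f x" if "x \<in> carr V" for x using that span by auto
  then have im: "f ` carr V = h ` V.span B" using span by (auto simp: image_def)
  have inj: "inj_on h (V.span B)" using f(2) hf span by (auto simp: inj_on_def)
  have "E.independent (h ` B)"
    using P.linear_independent_injective_image[OF h(1) B(2) inj] .
  then have "E.dim (E.span (h ` B)) = card (h ` B)" by (rule E.dim_span_eq_card_independent)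
  also have "E.span (h ` B) = f ` carr V" using P.linear_span_image[OF h(1)] im by simp
  also have "card (h ` B) = card B"
    using inj_on_subset[OF inj] V.span_superset by (intro card_image) auto
  finally show ?thesis using B by (simp add: alg_dim_def)
qed

lemma alg_iso_inverse:
  assumes "\<And>x y. x \<in> carr A \<Longrightarrow> y \<in> carr A \<Longrightarrow> x + y \<in> carr A"
    and "\<And>c x. x \<in> carr A \<Longrightarrow> scl A c x \<in> carr A"
    and "\<And>x y. x \<in> carr A \<Longrightarrow> y \<in> carr A \<Longrightarrow> brk A x y \<in> carr A"
    and f: "alg_hom A B f" "bij_betw f (carr A) (carr B)"
  shows "B \<simeq> A"
proof -
  let ?g = "inv_into (carr A) f"
  have g: "?g y \<in> carr A" "f (?g y) = y" if "y \<in> carr B" for y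
    using f(2) that by (auto simp: bij_betw_def f_inv_into_f inv_into_into)
  have eq: "?g y = x" if "x \<in> carr A" "f x = y" for x y
    using f(2) that by (auto simp: bij_betw_def)
  have "alg_hom B A ?g"
    unfolding alg_hom_def
    by (auto simp: g alg_homD[OF f(1)] assms(1-3) intro!: eq)
  then show ?thesis unfolding alg_iso_def using bij_betw_inv_into[OF f(2)] by blast
qed

section \<open>Non-split central extensions\<close>

text \<open>A kernel vector \<open>v\<close> outside the span of the brackets splits off: the kernel \<open>H\<close> of a functional
  that vanishes on brackets is closed under them whatever its elements are, and
  \<open>x \<mapsto> (x - \<phi>(x) v, \<phi>(x))\<close> identifies \<open>E\<close> with \<open>H\<close> plus an abelian line, because \<open>v\<close> is central.
  Since \<open>g v = 0\<close>, the algebra \<open>H\<close> is again a central extension of \<open>L\<close>, with kernel \<open>W\<close>.\<close>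

lemma kernel_in_derived_if_nonsplit:
  fixes E :: "'e::ab_group_add calgebra"
  assumes ns: "nonsplit_extension k L E" and "k \<ge> 1"
    and E: "leibniz_algebra E" and L: "leibniz_algebra L"
    and g: "alg_hom E L g" "g ` carr E = carr L"
    and ker: "{x \<in> carr E. g x = 0} \<subseteq> center E"
    and dim: "vector_space.dim (scl E) {x \<in> carr E. g x = 0} = k"
  shows "{x \<in> carr E. g x = 0} \<subseteq> module.span (scl E) {brk E x y |x y. x \<in> carr E \<and> y \<in> carr E}"
proof (rule ccontr)
  interpret leibniz_algebra E by fact
  interpret L: leibniz_algebra L by fact
  define K where "K = {x \<in> carr E. g x = 0}"
  define D where "D = {brk E x y |x y. x \<in> carr E \<and> y \<in> carr E}"
  assume "\<not> {x \<in> carr E. g x = 0} \<subseteq> span {brk E x y |x y. x \<in> carr E \<and> y \<in> carr E}"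
  then obtain v where v: "v \<in> K" "v \<notin> span D" unfolding K_def D_def by blast
  have vc: "v \<in> carr E" "g v = 0" "v \<in> center E" using v ker by (auto simp: K_def)
  obtain \<phi> where \<phi>: "Vector_Spaces.linear (scl E) (*) \<phi>" "\<phi> v = 1" "\<forall>x\<in>span D. \<phi> x = (0::complex)"
    using ex_functional[OF v(2)] by blast
  have \<phi>l: "\<phi> (x + y) = \<phi> x + \<phi> y" "\<phi> (scl E c x) = c * \<phi> x" for x y c
    using \<phi>(1) by (auto simp: Vector_Spaces.linear_iff)
  have \<phi>0: "\<phi> 0 = 0" using \<phi>l(1)[of 0 0] by simp
  have \<phi>d: "\<phi> (x - y) = \<phi> x - \<phi> y" for x y using \<phi>l(1)[of "x - y" y] by (simp add: algebra_simps)
  have \<phi>b: "\<phi> (brk E x y) = 0" if "x \<in> carr E" "y \<in> carr E" for x y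
    using \<phi>(3) that span_base[of _ D] by (auto simp: D_def)
  define H where "H = {x \<in> carr E. \<phi> x = 0}"
  define W where "W = {x \<in> K. \<phi> x = 0}"
  have subK: "subspace K"
    by (auto simp: K_def subspace_def in_carr alg_homD[OF g(1)] hom_zero[OF g(1)])
  have subH: "subspace H" by (auto simp: H_def subspace_def \<phi>l \<phi>0 in_carr)
  have subW: "subspace W" using subK by (auto simp: W_def subspace_def \<phi>l \<phi>0)
  define E' where "E' = E\<lparr>carr := H\<rparr>"
  have E': "leibniz_algebra E'"
    unfolding E'_def by (rule subalgebra[OF subH]) (auto simp: H_def \<phi>b in_carr)
  have zb: "brk E x y = 0" if "x \<in> W" "y \<in> W" for x y
    using that ker by (intro brk_center_left) (auto simp: W_def K_def)
  have W: "leibniz_algebra (E\<lparr>carr := W\<rparr>)"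
    by (rule subalgebra[OF subW]) (use subW in \<open>auto simp: zb subspace_0\<close>, auto simp: W_def K_def)
  \<comment> \<open>the projection onto \<open>H\<close> along the line through \<open>v\<close>\<close>
  define p where "p x = x - scl E (\<phi> x) v" for x
  have pH: "p x \<in> H" if "x \<in> carr E" for x
    using that by (auto simp: p_def H_def in_carr vc \<phi>d \<phi>l \<phi>(2))
  have gp: "g (p x) = g x" if "x \<in> carr E" for x
    using that vc by (simp add: p_def hom_diff[OF g(1)] alg_homD(3)[OF g(1)] in_carr)
  have pW: "p x \<in> W" if "x \<in> K" for x
    using pH[of x] gp[of x] that by (auto simp: W_def K_def H_def)
  have dimW: "dim W = k - 1"
  proof -
    obtain B where B: "B \<subseteq> W" "independent B" "W \<subseteq> span B" "card B = dim W"
      using basis_exists .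
    have "v \<notin> span B" using span_minimal[OF B(1) subW] \<phi>(2) by (auto simp: W_def)
    then have vB: "v \<notin> B" "independent (insert v B)"
      using span_base B(2) independent_insertI by auto
    have "x \<in> span (insert v B)" if "x \<in> K" for x
    proof -
      have "p x \<in> span (insert v B)" using pW[OF that] B(3) span_mono[of B "insert v B"] by auto
      then have "p x + scl E (\<phi> x) v \<in> span (insert v B)"
        by (intro span_add span_scale[OF span_base]) auto
      then show ?thesis by (simp add: p_def)
    qed
    then have "card (insert v B) = dim K"
      using B(1) v(1) vB(2) by (intro basis_card_eq_dim) (auto simp: W_def)
    then have card: "card (insert v B) = k" using dim by (simp add: K_def)
    then have "finite (insert v B)" using \<open>k \<ge> 1\<close> by (intro card_ge_0_finite) auto
    then show ?thesis using card vB(1) B(4) by auto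
  qed
  have "central_extension (k - 1) L E'"
    unfolding central_extension_def
  proof (intro conjI exI)
    show "alg_dim (E\<lparr>carr := W\<rparr>) = k - 1" using dimW by (simp add: alg_dim_def)
    have "g ` H = carr L"
    proof
      show "g ` H \<subseteq> carr L" using alg_homD(1)[OF g(1)] by (auto simp: H_def)
      show "carr L \<subseteq> g ` H"
      proof
        fix y assume "y \<in> carr L"
        then obtain x where "x \<in> carr E" "y = g x" using g(2) by blast
        then show "y \<in> g ` H" using gp pH by (intro image_eqI[of _ _ "p x"]) auto
      qed
    qed
    then show "short_exact (E\<lparr>carr := W\<rparr>) E' L id g"
      using g(1) by (auto simp: short_exact_def alg_hom_def E'_def W_def H_def K_def)
    show "id ` carr (E\<lparr>carr := W\<rparr>) \<subseteq> center E'"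
      using ker by (auto simp: center_def E'_def W_def H_def K_def subset_iff)
  qed (fact L E' W)+
  moreover have "E \<simeq> E' \<oplus> abelian_line"
    unfolding alg_iso_def
  proof (intro exI conjI)
    have pa: "p (x + y) = p x + p y" "p (scl E c x) = scl E c (p x)" for x y c
      by (simp_all add: p_def \<phi>l scale_left_distrib scale_right_diff_distrib)
    have "p (brk E x y) = brk E (p x) (p y)" if xy: "x \<in> carr E" "y \<in> carr E" for x y
    proof -
      have x: "p x + scl E (\<phi> x) v = x" and y: "p y + scl E (\<phi> y) v = y" by (simp_all add: p_def)
      have c: "p x \<in> carr E" "p y \<in> carr E" using pH xy by (auto simp: H_def)
      have "brk E x y = brk E (p x + scl E (\<phi> x) v) (p y + scl E (\<phi> y) v)" by (simp only: x y)
      also have "\<dots> = brk E (p x) (p y)"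
        using c vc by (simp add: brk_add_left brk_add_right brk_scl_left brk_scl_right in_carr
            brk_center_left brk_center_right)
      finally show ?thesis using \<phi>b[OF xy] by (simp add: p_def)
    qed
    then show "alg_hom E (E' \<oplus> abelian_line) (\<lambda>x. (p x, \<phi> x))"
      by (auto simp: alg_hom_def alg_sum_def abelian_line_def E'_def pH pa \<phi>l \<phi>b)
    show "bij_betw (\<lambda>x. (p x, \<phi> x)) (carr E) (carr (E' \<oplus> abelian_line))"
      by (rule bij_betw_byWitness[where f' = "\<lambda>(h, c). h + scl E c v"])
        (auto simp: p_def alg_sum_def abelian_line_def E'_def H_def \<phi>l \<phi>d \<phi>(2) in_carr vc)
  qed
  ultimately show False using ns \<open>k \<ge> 1\<close> by (auto simp: nonsplit_extension_def split_extension_def)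
qed

section \<open>Central extensions of the algebra F1\<close>

locale F1_extension = leibniz_algebra E for E :: "'e::ab_group_add calgebra" +
  fixes n :: nat and g :: "'e \<Rightarrow> nat \<Rightarrow> complex" and a b :: 'e
  assumes n: "n \<ge> 3"
    and hom: "alg_hom E (F1 n) g"
    and kernel_central: "\<lbrakk>x \<in> carr E; g x = 0\<rbrakk> \<Longrightarrow> x \<in> center E"
    and a: "a \<in> carr E" "g a = bvec 1"
    and b: "b \<in> carr E" "g b = bvec 2"
begin

text \<open>Indices are shifted by one: \<open>chain k\<close> is the left-normed product of \<open>k + 1\<close> factors \<open>a\<close>.\<close>

primrec chain :: "nat \<Rightarrow> 'e" where
  "chain 0 = a"
| "chain (Suc k) = brk E (chain k) a"

lemma chain_in_carr: "chain k \<in> carr E"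
  by (induction k) (auto simp: a brk_closed)

lemma g_chain: "g (chain (Suc k)) = (if k + 3 \<le> n then bvec (k + 3) else 0)"
proof (induction k)
  case 0
  show ?case using n by (auto simp: alg_homD(4)[OF hom] a brk_F1 bvec_def fun_eq_iff)
next
  case (Suc k)
  have "g (chain (Suc (Suc k))) = brk (F1 n) (g (chain (Suc k))) (bvec 1)"
    using alg_homD(4)[OF hom chain_in_carr a(1), of "Suc k"] a(2) by simp
  then show ?case unfolding Suc.IH
    using n by (auto simp: brk_F1 bvec_def fun_eq_iff)
qed

text \<open>For \<open>[a, a]\<close> the two terms of the Leibniz identity cancel; afterwards each of them contains a
  right multiplication by the preceding link.\<close>

lemma brk_right_chain: "x \<in> carr E \<Longrightarrow> brk E x (chain (Suc k)) = 0"
proof (induction k arbitrary: x)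
  case 0
  then show ?case using leibniz[of x a a] a by simp
next
  case (Suc k)
  have "brk E x (chain (Suc (Suc k)))
    = brk E (brk E x (chain (Suc k))) a - brk E (brk E x a) (chain (Suc k))"
    using leibniz[OF Suc.prems chain_in_carr a(1), of "Suc k"] by simp
  then show ?case using Suc a by (simp add: brk_zero_left brk_closed del: chain.simps)
qed

lemma g_brk_ab: "g (brk E a b) = 0" "g (brk E b b) = 0" "g (brk E b a - chain 1) = 0"
  using n by (auto simp: a b in_carr alg_homD(4)[OF hom] hom_diff[OF hom] brk_F1 bvec_def fun_eq_iff)

lemma brk_ab_central: "brk E a b \<in> center E"
  by (intro kernel_central g_brk_ab brk_closed a b)

text \<open>Read as \<open>[[y, a], b] = [y, [a, b]] + [[y, b], a]\<close>, the Leibniz identity moves \<open>b\<close> inwards, and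
  the first term vanishes because \<open>[a, b]\<close> is central. For \<open>y = a\<close> the second one does too, which
  starts the induction.\<close>

lemma brk_chain_b: "brk E (chain (Suc k)) b = 0"
proof (induction k)
  case 0
  show ?case using leibniz[OF a(1) a(1) b(1)] brk_ab_central a
    by (simp add: brk_center_left brk_center_right)
next
  case (Suc k)
  have "brk E (chain (Suc (Suc k))) b
    = brk E (chain (Suc k)) (brk E a b) + brk E (brk E (chain (Suc k)) b) a"
    using leibniz[OF chain_in_carr a(1) b(1), of "Suc k"] by (simp add: algebra_simps)
  then show ?case using brk_ab_central a chain_in_carr Suc
    by (simp add: brk_center_right brk_zero_left del: chain.simps)
qed

lemma g_chain_last: "g (chain (n - 1)) = 0"
proof -
  have "n - 1 = Suc (n - 2)" using n by simp
  then show ?thesis using g_chain[of "n - 2"] n by auto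
qed

text \<open>The order is that of the basis of \<open>F1_ext4 n\<close>: the indices up to \<open>n\<close> lift a basis of \<open>F1 n\<close>,
  and the last four lie in the kernel of \<open>g\<close>.\<close>

definition ext_basis :: "nat \<Rightarrow> 'e" where
  "ext_basis i = (if i < n then chain (i - 1)
     else if i = n then b
     else if i = n + 1 then brk E b a - chain 1
     else if i = n + 2 then chain (n - 1)
     else if i = n + 3 then brk E a b
     else brk E b b)"

lemma ext_basis_in_carr: "ext_basis i \<in> carr E"
  by (auto simp: ext_basis_def chain_in_carr in_carr a b)

lemma g_ext_basis_tail: "i > n \<Longrightarrow> g (ext_basis i) = 0"
  using g_brk_ab g_chain_last by (auto simp: ext_basis_def)

lemma ext_basis_central: "i > n \<Longrightarrow> ext_basis i \<in> center E"
  by (intro kernel_central ext_basis_in_carr g_ext_basis_tail)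

text \<open>The vanishing of all brackets apart from the listed ones is what the two chain lemmas and the
  centrality of the last four basis vectors provide, so \<open>F1_ext4 n\<close> maps to every central extension
  of \<open>F1 n\<close>.\<close>

lemma lin_comb_ext_basis_hom: "alg_hom (F1_ext4 n) E (lin_comb (n + 4) ext_basis)"
  unfolding F1_ext4_def
proof (rule lin_comb_hom)
  fix i j assume ij: "i \<in> {1..n + 4}" "j \<in> {1..n + 4}"
  have e: "ext_basis 1 = a" "ext_basis n = b" "ext_basis 2 = chain 1"
     "ext_basis (n + 1) = brk E b a - chain 1" "ext_basis (n + 2) = chain (n - 1)"
     "ext_basis (n + 3) = brk E a b" "ext_basis (n + 4) = brk E b b"
    using n by (auto simp: ext_basis_def)
  have ch: "ext_basis i = chain (i - 1)" if "i < n" for i using that by (simp add: ext_basis_def)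
  have chS: "ext_basis i = chain (Suc (i - 2))" if "i < n" "2 \<le> i" for i
  proof -
    have "i - 1 = Suc (i - 2)" using that by arith
    then show ?thesis using that by (simp only: ext_basis_def if_True)
  qed
  let ?t = "if 1 \<le> i \<and> i \<le> n - 2 \<and> j = 1 then bvec (i + 1)
     else if i = n - 1 \<and> j = 1 then bvec (n + 2)
     else if i = n \<and> j = 1 then bvec 2 + bvec (n + 1)
     else if i = 1 \<and> j = n then bvec (n + 3)
     else if i = n \<and> j = n then bvec (n + 4)
     else 0"
  have "i > n \<or> i = n \<or> i = n - 1 \<or> i < n - 1" "i > n \<or> i = n \<or> i = 1 \<or> 2 \<le> i \<and> i < n"
    "j > n \<or> j = n \<or> j = 1 \<or> 2 \<le> j \<and> j < n"
    using ij by auto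
  then consider "i > n" | "j > n" | "2 \<le> j" "j < n" | "i < n - 1" "j = 1"
    | "i = n - 1" "j = 1" | "i = n" "j = 1" | "i = 1" "j = n" | "2 \<le> i" "i < n" "j = n"
    | "i = n" "j = n"
    by argo
  then show "brk E (ext_basis i) (ext_basis j) = lin_comb (n + 4) ext_basis ?t"
  proof cases
    case 1
    then show ?thesis
      using n by (auto simp: lin_comb_0 brk_center_left ext_basis_central ext_basis_in_carr)
  next
    case 2
    then show ?thesis
      using n by (auto simp: lin_comb_0 brk_center_right ext_basis_central ext_basis_in_carr)
  next
    case 3
    then show ?thesis using n ij by (simp add: lin_comb_0 chS brk_right_chain ext_basis_in_carr del: chain.simps)
  next
    case 4
    have "Suc (i - 1) = i" using ij by simp
    then have "chain i = brk E (chain (i - 1)) a" using chain.simps(2)[of "i - 1"] by (simp only:)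
    then show ?thesis using 4 n ij e by (auto simp: lin_comb_bvec ch)
  next
    case 5
    have "Suc (i - 1) = i" using ij by simp
    then have "chain i = brk E (chain (i - 1)) a" using chain.simps(2)[of "i - 1"] by (simp only:)
    then show ?thesis using 5 n ij e by (auto simp: lin_comb_bvec ch)
  next
    case 6
    then show ?thesis using n e by (auto simp: lin_comb_bvec lin_comb_add simp del: chain.simps)
  next
    case 7
    then show ?thesis using n e by (auto simp: lin_comb_bvec)
  next
    case 8
    then show ?thesis using n e by (auto simp: lin_comb_0 chS brk_chain_b simp del: chain.simps)
  next
    case 9
    then show ?thesis using n e by (auto simp: lin_comb_bvec)
  qed
qed (rule ext_basis_in_carr)

lemma g_ext_basis:
  assumes "i \<ge> 1"
  shows "g (ext_basis i)
    = (if i = 1 then bvec 1 else if i = n then bvec 2 else if i < n then bvec (i + 1) else 0)"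
proof -
  consider "i > n" | "i = n" | "i = 1" | "2 \<le> i" "i < n" using assms by linarith
  then show ?thesis
  proof cases
    case 1
    then show ?thesis using n by (simp add: g_ext_basis_tail)
  next
    case 2
    then show ?thesis using n by (simp add: ext_basis_def b)
  next
    case 3
    then show ?thesis using n by (simp add: ext_basis_def a)
  next
    case 4
    then have "i - 1 = Suc (i - 2)" "i - 2 + 3 = i + 1" by arith+
    then have "g (ext_basis i) = (if i + 1 \<le> n then bvec (i + 1) else 0)"
      using 4 g_chain[of "i - 2"] by (simp only: ext_basis_def if_True)
    then show ?thesis using 4 by simp
  qed
qed

text \<open>The first \<open>n\<close> basis vectors lift the standard basis in permuted order \<open>1, 3, ..., n, 2\<close>; the
  index on the right-hand side is the inverse permutation.\<close>

lemma g_lin_comb: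
  "g (lin_comb (n + 4) ext_basis z)
    = (\<lambda>k. if 1 \<le> k \<and> k \<le> n then z (if k = 1 then 1 else if k = 2 then n else k - 1) else 0)"
proof
  fix k
  define s where "s = (if k = 1 then 1 else if k = 2 then n else k - 1)"
  have gs: "g (ext_basis i) k = (if i = s then if 1 \<le> k \<and> k \<le> n then 1 else 0 else 0)"
    if "i \<in> {1..n+4}" for i
  proof -
    have i: "i \<ge> 1" using that by simp
    consider "k = 0" | "k = 1" | "k = 2" | "3 \<le> k" by linarith
    then show ?thesis
      unfolding g_ext_basis[OF i] using n i by cases (auto simp: s_def bvec_def)
  qed
  have s: "s \<in> {1..n+4}" if "1 \<le> k \<and> k \<le> n" using that n by (auto simp: s_def)
  have "g (lin_comb (n + 4) ext_basis z) k = (\<Sum>i=1..n+4. z i * g (ext_basis i) k)"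
    unfolding lin_comb_def
    by (simp add: hom_sum[OF hom] scl_in_carr ext_basis_in_carr alg_homD(3)[OF hom] sum_fun_at
        F1_def table_algebra_def del: sum.cl_ivl_Suc)
  also have "\<dots> = (\<Sum>i=1..n+4. if i = s then if 1 \<le> k \<and> k \<le> n then z i else 0 else 0)"
    by (intro sum.cong refl) (simp add: gs)
  also have "\<dots> = (if 1 \<le> k \<and> k \<le> n then z s else 0)"
    using s by (simp only: sum.delta finite_atLeastAtMost) auto
  finally show "g (lin_comb (n + 4) ext_basis z) k
    = (if 1 \<le> k \<and> k \<le> n then z (if k = 1 then 1 else if k = 2 then n else k - 1) else 0)"
    by (simp only: s_def)
qed

lemma lin_comb_in_kernel:
  assumes "g (lin_comb (n + 4) ext_basis z) = 0"
  shows "i \<in> {1..n} \<Longrightarrow> z i = 0"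
    and "lin_comb (n + 4) ext_basis z = (\<Sum>i=n+1..n+4. scl E (z i) (ext_basis i))"
proof -
  have z: "z (if k = 1 then 1 else if k = 2 then n else k - 1) = 0" if "1 \<le> k" "k \<le> n" for k
    using fun_cong[OF assms, of k] that unfolding g_lin_comb by simp
  show z0: "z i = 0" if i: "i \<in> {1..n}" for i
  proof -
    consider "i = 1" | "i = n" | "2 \<le> i" "i < n" using i by fastforce
    then show ?thesis using z[of 1] z[of 2] z[of "i + 1"] n by cases auto
  qed
  have "{1..n+4} = {1..n} \<union> {n+1..n+4}" by auto
  then show "lin_comb (n + 4) ext_basis z = (\<Sum>i=n+1..n+4. scl E (z i) (ext_basis i))"
    unfolding lin_comb_def by (subst sum.mono_neutral_right[of "{1..n+4}" "{n+1..n+4}"]) (auto simp: z0)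
qed

text \<open>Surjectivity uses that \<open>K\<close> is spanned by brackets, and brackets do not see the difference between
  an element and its approximation modulo the central \<open>K\<close>. Injectivity is the dimension count on
  \<open>K\<close>.\<close>

lemma iso_F1_ext4:
  assumes derived: "{x \<in> carr E. g x = 0} \<subseteq> span {brk E x y |x y. x \<in> carr E \<and> y \<in> carr E}"
    and dim: "dim {x \<in> carr E. g x = 0} = 4"
  shows "E \<simeq> F1_ext4 n"
proof -
  let ?T = "F1_ext4 n" and ?K = "{x \<in> carr E. g x = 0}"
  define h where "h = lin_comb (n + 4) ext_basis"
  have h_carr: "h z \<in> carr E" for z
    unfolding h_def by (intro lin_comb_in_carr ext_basis_in_carr)
  have trunc: "h z \<in> h ` carr ?T" for z
  proof (rule image_eqI)
    show "h z = h (\<lambda>i. if i \<in> {1..n+4} then z i else 0)"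
      unfolding h_def lin_comb_def by (intro sum.cong) auto
  qed (auto simp: F1_ext4_def table_algebra_def)
  have brk_h: "brk E x y \<in> range h" if "x \<in> range h" "y \<in> range h" for x y
  proof -
    have "x \<in> h ` carr ?T" "y \<in> h ` carr ?T" using that trunc by auto
    then obtain z z' where "z \<in> carr ?T" "z' \<in> carr ?T" "x = h z" "y = h z'" by auto
    then have "brk E x y = h (brk ?T z z')"
      using alg_homD(4)[OF lin_comb_ext_basis_hom] by (simp add: h_def)
    then show ?thesis by simp
  qed
  \<comment> \<open>The coordinates are those of \<open>g x\<close>, permuted as the basis vectors lift them.\<close>
  have lift: "\<exists>z. x - h z \<in> ?K" if x: "x \<in> carr E" for x
  proof -
    define z where "z k = (if k = n then g x 2 else if k = 1 then g x 1 else g x (k + 1))" for k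
    have "g x k = 0" if "k = 0 \<or> k > n" for k
      using alg_homD(1)[OF hom x] that by (auto simp: F1_def table_algebra_def)
    then have "g (h z) = g x"
      using n unfolding h_def g_lin_comb by (auto simp: z_def fun_eq_iff)
    then have "x - h z \<in> ?K" using x h_carr by (simp add: hom_diff[OF hom] diff_in_carr)
    then show ?thesis by blast
  qed
  have sub: "subspace (range h)"
    unfolding subspace_def h_def
    by (auto simp flip: lin_comb_add lin_comb_scale) (metis lin_comb_0 rangeI)
  have "brk E x y \<in> range h" if xy: "x \<in> carr E" "y \<in> carr E" for x y
  proof -
    obtain z z' where z: "x - h z \<in> ?K" "y - h z' \<in> ?K" using lift xy by meson
    define \<kappa> \<kappa>' where "\<kappa> = x - h z" and "\<kappa>' = y - h z'"
    then have x: "x = h z + \<kappa>" and y: "y = h z' + \<kappa>'" and "\<kappa> \<in> ?K" "\<kappa>' \<in> ?K"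
      using z by simp_all
    then have c: "\<kappa> \<in> carr E" "\<kappa>' \<in> carr E" "\<kappa> \<in> center E" "\<kappa>' \<in> center E"
      using kernel_central by auto
    have "brk E x y = brk E (h z) (h z')"
      unfolding x y using c h_carr
      by (simp add: brk_add_left brk_add_right brk_center_left brk_center_right in_carr)
    then show ?thesis using brk_h by simp
  qed
  then have "span {brk E x y |x y. x \<in> carr E \<and> y \<in> carr E} \<subseteq> range h"
    by (intro span_minimal sub) auto
  then have K_range: "?K \<subseteq> range h" using derived by blast
  have "x \<in> h ` carr ?T" if x: "x \<in> carr E" for x
  proof -
    obtain z where "x - h z \<in> range h" using lift[OF x] K_range by blast
    then have "x - h z + h z \<in> range h" using sub by (intro subspace_add) auto
    then show ?thesis using trunc by auto
  qed
  then have surj: "h ` carr ?T = carr E" using h_carr by auto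
  have K_span: "?K \<subseteq> span (ext_basis ` {n+1..n+4})"
  proof
    fix x assume x: "x \<in> ?K"
    then obtain z where "x = h z" using K_range by blast
    then have "x = (\<Sum>i=n+1..n+4. scl E (z i) (ext_basis i))"
      using x lin_comb_in_kernel(2)[of z] by (simp add: h_def)
    moreover have "(\<Sum>i=n+1..n+4. scl E (z i) (ext_basis i)) \<in> span (ext_basis ` {n+1..n+4})"
      by (intro span_sum span_scale span_base imageI)
    ultimately show "x \<in> span (ext_basis ` {n+1..n+4})" by (simp only:)
  qed
  have K_basis: "ext_basis ` {n+1..n+4} \<subseteq> ?K" by (auto simp: ext_basis_in_carr g_ext_basis_tail)
  have inj: "inj_on h (carr ?T)"
  proof (rule inj_onI)
    fix x y assume xy: "x \<in> carr ?T" "y \<in> carr ?T" "h x = h y"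
    define w where "w = x - y"
    have "h x = h w + h y" unfolding h_def w_def by (simp flip: lin_comb_add)
    then have w: "h w = 0" using xy by simp
    then have gw: "g (lin_comb (n + 4) ext_basis w) = 0"
      using hom_zero[OF hom] by (simp add: h_def)
    have "w i = 0" if "i \<in> {n+1..n+4}" for i
      using lin_comb_in_kernel(2)[OF gw] w dim K_span K_basis that
      by (intro independent_family[of "{n+1..n+4}" ?K ext_basis w i]) (auto simp: h_def simp del: sum.cl_ivl_Suc)
    moreover have "w i = 0" if "i \<notin> {1..n+4}" for i
      using xy that by (auto simp: w_def F1_ext4_def table_algebra_def)
    ultimately have "w i = 0" for i
      using lin_comb_in_kernel(1)[OF gw, of i] by (cases "i \<in> {1..n}"; cases "i \<in> {1..n+4}") auto
    then show "x = y" by (auto simp: w_def fun_eq_iff)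
  qed
  show ?thesis
  proof (rule alg_iso_inverse)
    show "alg_hom ?T E h" unfolding h_def by (rule lin_comb_ext_basis_hom)
    show "bij_betw h (carr ?T) (carr E)" using inj surj by (simp add: bij_betw_def)
    show "brk ?T x y \<in> carr ?T" for x y
      by (auto simp: F1_ext4_def table_algebra_def bvec_def intro!: sum.neutral)
  qed (auto simp: F1_ext4_def table_algebra_def)
qed

end

theorem theorem4p8:
  fixes n :: nat and E :: "'e::ab_group_add calgebra"
  assumes "n \<ge> 3"
    and "nonsplit_extension 4 (F1 n) E"
  shows "E \<simeq> F1_ext4 n"
proof -
  \<comment> \<open>The dimension is given for the abstract algebra \<open>V\<close>; it is carried over to the kernel of \<open>g\<close>.\<close>
  obtain V :: "'e calgebra" and f g where
    E: "leibniz_algebra E" and L: "leibniz_algebra (F1 n)" and V: "leibniz_algebra V" "alg_dim V = 4"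
    and ex: "short_exact V E (F1 n) f g" and cen: "f ` carr V \<subseteq> center E"
    using assms(2) by (auto simp: nonsplit_extension_def central_extension_def)
  have f: "alg_hom V E f" "inj_on f (carr V)" "f ` carr V = {x \<in> carr E. g x = 0}"
    and g: "alg_hom E (F1 n) g" "g ` carr E = carr (F1 n)"
    using ex by (auto simp: short_exact_def)
  have ker: "{x \<in> carr E. g x = 0} \<subseteq> center E" using cen f(3) by simp
  have dim: "vector_space.dim (scl E) {x \<in> carr E. g x = 0} = 4"
    using dim_injective_hom_image[OF V(1) E f(1,2)] V(2) f(3) by simp
  have "bvec 1 \<in> carr (F1 n)" "bvec 2 \<in> carr (F1 n)"
    using assms(1) by (auto simp: F1_def table_algebra_def bvec_def)
  then obtain a b where "a \<in> carr E" "g a = bvec 1" "b \<in> carr E" "g b = bvec 2"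
    using g(2) by (metis imageE)
  then interpret F1_extension E n g a b
    using E assms(1) g(1) ker by (intro F1_extension.intro F1_extension_axioms.intro) auto
  show ?thesis
    by (intro iso_F1_ext4 kernel_in_derived_if_nonsplit[OF assms(2) _ E L g ker dim] dim) simp
qed

end
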